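(* (a) If $A,B\in M_2(\mathbb R)$ are normal and skew-aligned, then $\mathcal M_{\mathbb R}(\exp(A)\exp(B))<\|A\|_2+\|B\|_2$. (b) If $A,B\in M_2(\mathbb C)$ are normal and skew-aligned, then $\mathcal M_{\mathbb C}(\exp(A)\exp(B))<\|A\|_2+\|B\|_2$.
   Context: $\|\cdot\|_2$ is the operator norm. $\mathcal M_{\mathbb F}(A)=\inf\{\sum_{i=1}^k\|B_i\|_2: k\ge1,\ B_i\in M_2(\mathbb F),\ \exp(B_k)\cdots\exp(B_1)=A\}$ (Magnus exponent). Normal $A,B$ are skew-aligned if, after a simultaneous unitary conjugation, $A=r_1\begin{pmatrix}e^{i\eta}\cos t&-e^{i\theta}\sin t\\ e^{i\eta}\sin t&e^{i\theta}\cos t\end{pmatrix}$, $B=r_2\begin{pmatrix}e^{i\eta}\cos t&-e^{i\phi}\sin t\\ e^{i\eta}\sin t&e^{i\phi}\cos t\end{pmatrix}$ with $r_1,r_2>0$, $t\in(0,\pi)$, $\eta,\theta,\phi\in[0,2\pi)$, $\phi\ne\theta$. *)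

theory Defs
  imports "HOL-Analysis.Analysis"
begin

primrec mpow :: "'a::semiring_1^'n^'n \<Rightarrow> nat \<Rightarrow> 'a^'n^'n" where
  "mpow A 0 = mat 1"
| "mpow A (Suc k) = A ** mpow A k"

definition mexp :: "'a::{real_normed_field,banach}^'n^'n \<Rightarrow> 'a^'n^'n" where
  "mexp A = (\<Sum>k. (1 / fact k) *\<^sub>R mpow A k)"

definition opnorm :: "'a::{real_normed_field}^'n^'n \<Rightarrow> real" where
  "opnorm A = onorm (\<lambda>x. A *v x)"

text \<open>Magnus exponent: infimum of sum of norms of B_1..B_k (k>=1) with
  exp(B_k) ... exp(B_1) = A; list [B_1,...,B_k].\<close>
definition exp_prod :: "('a::{real_normed_field,banach}^'n^'n) list \<Rightarrow> 'a^'n^'n" where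
  "exp_prod Bs = foldr (\<lambda>B P. P ** mexp B) Bs (mat 1)"

definition magnus :: "'a::{real_normed_field,banach}^'n^'n \<Rightarrow> real" where
  "magnus A = Inf {sum_list (map opnorm Bs) | Bs. Bs \<noteq> [] \<and> exp_prod Bs = A}"

definition cadj :: "complex^'n^'n \<Rightarrow> complex^'n^'n" where
  "cadj A = transpose (map_matrix cnj A)"

definition cnormal :: "complex^'n^'n \<Rightarrow> bool" where
  "cnormal A \<longleftrightarrow> A ** cadj A = cadj A ** A"

definition unitary :: "complex^'n^'n \<Rightarrow> bool" where
  "unitary U \<longleftrightarrow> U ** cadj U = mat 1 \<and> cadj U ** U = mat 1"

definition rnormal :: "real^'n^'n \<Rightarrow> bool" where
  "rnormal A \<longleftrightarrow> A ** transpose A = transpose A ** A"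

definition cplx :: "real^'n^'n \<Rightarrow> complex^'n^'n" where
  "cplx A = map_matrix complex_of_real A"

definition skew_form :: "real \<Rightarrow> real \<Rightarrow> real \<Rightarrow> real \<Rightarrow> complex^2^2" where
  "skew_form t \<eta> \<theta> r = (\<chi> i j. complex_of_real r *
     (if i = 1 then (if j = 1 then cis \<eta> * cos t else - cis \<theta> * sin t)
      else (if j = 1 then cis \<eta> * sin t else cis \<theta> * cos t)))"

definition skew_aligned :: "complex^2^2 \<Rightarrow> complex^2^2 \<Rightarrow> bool" where
  "skew_aligned A B \<longleftrightarrow>
     (\<exists>U r1 r2 t \<eta> \<theta> \<phi>. unitary U \<and> r1 > 0 \<and> r2 > 0 \<and> 0 < t \<and> t < pi \<and>
        \<eta> \<in> {0..<2*pi} \<and> \<theta> \<in> {0..<2*pi} \<and> \<phi> \<in> {0..<2*pi} \<and> \<phi> \<noteq> \<theta> \<and>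
        U ** A ** cadj U = skew_form t \<eta> \<theta> r1 \<and>
        U ** B ** cadj U = skew_form t \<eta> \<phi> r2)"

end

theory Submission
  imports Defs
begin

text \<open>
  View a product of exponentials as a path whose velocity is \<open>B\<close> and then \<open>A\<close>, and whose length is measured by
  the operator norm. Both velocities are dilations of unitaries that agree on the vector \<open>e\<close>, sending it to
  a multiple of \<open>u\<close>, and \<open>e\<close> is, up to scalars, the only vector at which \<open>A + B\<close> attains its norm. Hence the
  norm is differentiable at \<open>A + B\<close> with derivative \<open>D \<mapsto> Re \<langle>u, D e\<rangle>\<close>, and a perturbation \<open>D\<close> placed at the
  corner costs exactly this functional to first order. Transported along \<open>A\<close> for a time \<open>s\<close>, the functional
  has dual norm \<open>T = \<parallel>exp (s A) e\<parallel> \<cdot> \<parallel>exp (- s A*) u\<parallel> \<ge> 1\<close>, with \<open>T > 1\<close> for some \<open>s\<close> unless \<open>e\<close> is an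
  eigenvector of \<open>A + A*\<close> (the failure of the Pontryagin maximum principle). If \<open>T > 1\<close>, replacing \<open>A\<close> for a
  short time by the norming element \<open>X\<close> and compensating at the corner shortens the path; the second-order
  closing error is the exponential of an element of norm \<open>o(h)\<close>. Inverting the product exchanges \<open>(A, B)\<close> with
  \<open>(-B, -A)\<close>, and \<open>e\<close> cannot be an eigenvector of both \<open>A + A*\<close> and \<open>B + B*\<close>, since that would force
  \<open>\<theta> = - \<eta> = \<phi>\<close> modulo \<open>2 \<pi>\<close>. For real matrices one takes the real part of \<open>X\<close>.
\<close>

section \<open>Exponentials and needle variations in Banach algebras\<close>

lemma norm_power_diff_radius:
  fixes x y :: "'b::real_normed_algebra_1"
  assumes "norm x \<le> r" "norm y \<le> r" "r > 0"
  shows "norm (x ^ Suc n - y ^ Suc n) \<le> real (Suc n) * r ^ n * norm (x - y)"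
proof (induction n)
  case (Suc n)
  have "norm (x ^ Suc (Suc n) - y ^ Suc (Suc n)) = norm (x * (x ^ Suc n - y ^ Suc n) + (x - y) * y ^ Suc n)"
    by (simp add: algebra_simps)
  also have "\<dots> \<le> norm x * norm (x ^ Suc n - y ^ Suc n) + norm (x - y) * norm (y ^ Suc n)"
    by (intro norm_triangle_le add_mono norm_mult_ineq)
  also have "\<dots> \<le> r * (real (Suc n) * r ^ n * norm (x - y)) + norm (x - y) * r ^ Suc n"
    using assms Suc power_mono[OF assms(2), of "Suc n"] norm_power_ineq[of y "Suc n"]
    by (intro add_mono mult_mono mult_left_mono) auto
  also have "\<dots> = real (Suc (Suc n)) * r ^ Suc n * norm (x - y)"
    by (simp add: algebra_simps)
  finally show ?case .
qed simp

text \<open>The contraction estimate for constructing a logarithm. In the term of degree n + 2, the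
  factor n + 2 from differentiating the power cancels against the factorial. What remains is
  dominated by a geometric series of ratio 1/4, whose sum gives the constant 1/3.\<close>

lemma exp_remainder_lipschitz:
  fixes x y :: "'b::{real_normed_algebra_1,banach}"
  assumes "norm x \<le> 1/4" "norm y \<le> 1/4"
  shows "norm ((exp x - 1 - x) - (exp y - 1 - y)) \<le> (1/3) * norm (x - y)"
proof -
  let ?t = "\<lambda>x n. inverse (fact (n + 2)) *\<^sub>R (x ^ (n + 2)) :: 'b"
  have sm: "summable (?t x)" for x
    using summable_ignore_initial_segment[OF summable_exp_generic[of x], of 2] .
  have "(exp x - 1 - x) - (exp y - 1 - y) = (\<Sum>n. ?t x n - ?t y n)"
    by (simp add: exp_first_two_terms[of x] exp_first_two_terms[of y] suminf_diff[OF sm sm, symmetric]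
        del: fact_Suc power_Suc add_2_eq_Suc')
  also have "norm \<dots> \<le> (\<Sum>n. (1/4) * norm (x - y) * (1/4) ^ n)"
  proof (rule norm_suminf_le)
    fix n
    have "norm (?t x n - ?t y n) = inverse (fact (n + 2)) * norm (x ^ Suc (n+1) - y ^ Suc (n+1))"
      by (simp flip: scaleR_right_diff_distrib)
    also have "\<dots> \<le> inverse (fact (n + 2)) * (real (Suc (n+1)) * (1/4) ^ (n+1) * norm (x - y))"
      using assms by (intro mult_left_mono norm_power_diff_radius) auto
    also have "\<dots> = inverse (fact (n + 1)) * ((1/4) ^ (n+1) * norm (x - y))"
      using fact_Suc[of "n + 1", where 'a=real] by (simp add: divide_simps del: fact_Suc of_nat_add)
    also have "\<dots> \<le> 1 * ((1/4) ^ (n+1) * norm (x - y))"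
      by (intro mult_right_mono) (auto simp: inverse_le_1_iff fact_ge_1 simp del: fact_Suc)
    also have "\<dots> = (1/4) * norm (x - y) * (1/4) ^ n" by simp
    finally show "norm (?t x n - ?t y n) \<le> (1/4) * norm (x - y) * (1/4) ^ n" .
  qed (auto intro!: summable_mult summable_geometric)
  also have "\<dots> = (1/3) * norm (x - y)"
    by (subst suminf_mult) (auto simp: suminf_geometric summable_geometric)
  finally show ?thesis .
qed

text \<open>A logarithm of \<open>1 + E\<close> is a fixed point of
  \<open>L \<mapsto> E - (exp L - 1 - L)\<close>. This map preserves the ball of radius 1/4, since
  1/8 + (1/3)(1/4) < 1/4. The fixed point equation also bounds the norm of \<open>L\<close> linearly
  by that of \<open>E\<close>.\<close>

lemma exists_log_near_one:
  fixes E :: "'b::{real_normed_algebra_1,banach}"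
  assumes "norm E \<le> 1/8"
  shows "\<exists>L. exp L = 1 + E \<and> norm L \<le> 2 * norm E"
proof -
  define F where "F L = E - (exp L - 1 - L)" for L
  have R: "norm (exp L - 1 - L) \<le> (1/3) * norm L" if "norm L \<le> 1/4" for L :: 'b
    using exp_remainder_lipschitz[of L 0] that by simp
  have "\<exists>!L. L \<in> cball 0 (1/4) \<and> F L = L"
  proof (rule Banach_fix[where c = "1/3"])
    show "F ` cball 0 (1/4) \<subseteq> cball 0 (1/4)"
    proof clarsimp
      fix L :: 'b assume "norm L * 4 \<le> 1"
      then show "norm (F L) * 4 \<le> 1"
        using R[of L] norm_triangle_ineq4[of E "exp L - 1 - L"] assms by (simp add: F_def)
    qed
    show "dist (F x) (F y) \<le> 1/3 * dist x y" if "x \<in> cball 0 (1/4)" "y \<in> cball 0 (1/4)" for x y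
    proof -
      have "F x - F y = - ((exp x - 1 - x) - (exp y - 1 - y))" by (simp add: F_def)
      then show ?thesis
        using exp_remainder_lipschitz[of x y] that by (metis dist_norm mem_cball_0 norm_minus_cancel)
    qed
  qed (auto simp: complete_eq_closed)
  then obtain L where L: "norm L \<le> 1/4" "F L = L" by auto
  then have "norm L \<le> norm E + (1/3) * norm L"
    using R[of L] norm_triangle_ineq4[of E "exp L - 1 - L"] by (simp add: F_def)
  moreover have "exp L = 1 + E" using L(2) by (simp add: F_def algebra_simps)
  ultimately show ?thesis by (intro exI[of _ L]) (use norm_ge_zero[of E] in linarith)
qed

text \<open>The factors are listed from left to right as they are multiplied, opposite to the time
  order used in \<open>exp_prod\<close>.\<close>

definition shortcut :: "'b::{real_normed_algebra_1,banach} \<Rightarrow> 'b \<Rightarrow> bool" where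
  "shortcut A B \<longleftrightarrow> (\<exists>Xs. Xs \<noteq> [] \<and> prod_list (map exp Xs) = exp A * exp B \<and>
     sum_list (map norm Xs) < norm A + norm B)"

lemma prod_list_exp_uminus_rev:
  fixes Xs :: "'b::{real_normed_algebra_1,banach} list"
  shows "prod_list (map exp (map uminus (rev Xs))) * prod_list (map exp Xs) = 1"
proof (induction Xs)
  case (Cons a Xs)
  have "exp (- a) * exp a = 1" using exp_minus_inverse[of "- a"] by simp
  with Cons show ?case by (simp add: mult.assoc) (metis mult.assoc mult_1_left)
qed simp

text \<open>Reversing and negating a factorization inverts its product and keeps its length. It thus
  suffices to shorten the inverse path, where the negative of \<open>B\<close> plays the role of
  \<open>A\<close>.\<close>

lemma shortcut_inverse:
  fixes A B :: "'b::{real_normed_algebra_1,banach}"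
  assumes "shortcut (- B) (- A)"
  shows "shortcut A B"
proof -
  from assms obtain Xs where Xs: "Xs \<noteq> []" "prod_list (map exp Xs) = exp (- B) * exp (- A)"
    "sum_list (map norm Xs) < norm A + norm B" unfolding shortcut_def by (auto simp: add.commute)
  let ?Ys = "map uminus (rev Xs)"
  have 1: "exp (- B) * exp (- A) * (exp A * exp B) = 1"
    using exp_minus_inverse[of "- A"] exp_minus_inverse[of "- B"]
    by (simp add: mult.assoc) (metis mult.assoc mult_1_left)
  have "prod_list (map exp ?Ys) * (exp (- B) * exp (- A)) = 1"
    using prod_list_exp_uminus_rev[of Xs] Xs(2) by simp
  then have "prod_list (map exp ?Ys) = exp A * exp B"
    using 1 by (metis mult.assoc mult_1_left mult_1_right)
  moreover have "sum_list (map norm ?Ys) = sum_list (map norm Xs)"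
    by (simp add: comp_def flip: rev_map)
  ultimately show ?thesis using Xs unfolding shortcut_def by (intro exI[of _ ?Ys]) auto
qed

text \<open>Replace \<^term>\<open>A\<close> by \<^term>\<open>X\<close> for a time \<^term>\<open>h\<close> at distance \<^term>\<open>s\<close> from the corner, and a
  neighbourhood of the corner of size \<^term>\<open>h * N\<close> by the single exponential that closes the product to first order
  in \<^term>\<open>h\<close>. The inequality says that the length drops to first order.\<close>
definition needle :: "'b::{real_normed_algebra_1,banach} \<Rightarrow> 'b \<Rightarrow> bool" where
  "needle A B \<longleftrightarrow> (\<exists>s N X. 0 < s \<and> s < 1 \<and> 0 < N \<and>
     norm X + norm (N *\<^sub>R (A + B) + A - exp (- s *\<^sub>R A) * X * exp (s *\<^sub>R A))
       < norm A + N * (norm A + norm B))"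

lemma exp_scaleR_add:
  fixes A :: "'b::{real_normed_algebra_1,banach}"
  shows "exp (a *\<^sub>R A) * exp (b *\<^sub>R A) = exp ((a + b) *\<^sub>R A)"
  by (simp add: scaleR_add_left exp_add_commuting[symmetric])

text \<open>The varied list \<open>Xs h\<close> is shorter than the original path by exactly
  \<open>h * g\<close>. The factor \<open>V h\<close> that it misses satisfies
  \<open>V 0 = 1\<close> and has derivative 0 there, so it is the exponential of some
  \<open>L\<close> of norm o(h), which uses up only part of the gain.\<close>

lemma needle_imp_shortcut:
  fixes A B :: "'b::{real_normed_algebra_1,banach}"
  assumes "needle A B"
  shows "shortcut A B"
proof -
  from assms obtain s N X where s: "0 < s" "s < 1" and N: "0 < N" and
    less: "norm X + norm (N *\<^sub>R (A + B) + A - exp (- s *\<^sub>R A) * X * exp (s *\<^sub>R A))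
       < norm A + N * (norm A + norm B)" unfolding needle_def by blast
  define Y where "Y = N *\<^sub>R (A + B) + A - exp (- s *\<^sub>R A) * X * exp (s *\<^sub>R A)"
  define g where "g = norm A + N * (norm A + norm B) - norm X - norm Y"
  have g: "g > 0" using less by (simp add: g_def Y_def)
  define Xs where "Xs h = [(1 - s - h) *\<^sub>R A, h *\<^sub>R X, (s - h * N) *\<^sub>R A, h *\<^sub>R Y, (1 - h * N) *\<^sub>R B]" for h
  define V where "V h = prod_list (map exp (map uminus (rev (Xs h)))) * (exp A * exp B)" for h
  \<comment> \<open>\<open>W\<close> is what is left of \<open>V\<close> once the exponentials of
    fixed length are merged and cancelled. Apart from \<open>exp (- s *\<^sub>R A)\<close>, each of
    its factors is 1 at \<open>h = 0\<close>, so the product rule reads off the first-order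
    terms.\<close>
  define W where "W h = exp (h *\<^sub>R (N *\<^sub>R B)) * exp (h *\<^sub>R (- Y)) * exp (h *\<^sub>R (N *\<^sub>R A)) * exp (- s *\<^sub>R A)
      * exp (h *\<^sub>R (- X)) * exp (h *\<^sub>R A)" for h
  have "V h = exp (- B) * W h * (exp (s *\<^sub>R A) * exp B)" for h
  proof -
    have a: "exp (- ((1 - h * N) *\<^sub>R B)) = exp (- B) * exp (h *\<^sub>R (N *\<^sub>R B))"
      using exp_scaleR_add[of "-1" B "h * N"] by (simp add: algebra_simps)
    have b: "exp (- ((s - h * N) *\<^sub>R A)) = exp (h *\<^sub>R (N *\<^sub>R A)) * exp (- s *\<^sub>R A)"
      using exp_scaleR_add[of "h * N" A "- s"] by (simp add: algebra_simps)
    have "exp (- ((1 - s - h) *\<^sub>R A)) * exp A = exp ((h + s) *\<^sub>R A)"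
      using exp_scaleR_add[of "- (1 - s - h)" A 1] by (simp add: algebra_simps)
    also have "\<dots> = exp (h *\<^sub>R A) * exp (s *\<^sub>R A)" by (rule exp_scaleR_add[symmetric])
    finally have c: "exp (- ((1 - s - h) *\<^sub>R A)) * (exp A * z) = exp (h *\<^sub>R A) * (exp (s *\<^sub>R A) * z)" for z
      by (metis mult.assoc)
    show ?thesis unfolding V_def W_def Xs_def by (simp add: a b c mult.assoc)
  qed
  then have V_eq: "V = (\<lambda>h. exp (- B) * W h * (exp (s *\<^sub>R A) * exp B))" by auto
  have E: "((\<lambda>h. exp (h *\<^sub>R Z)) has_vector_derivative Z) (at 0)" for Z :: 'b
    using exp_scaleR_has_vector_derivative_right[of Z 0 UNIV] by simp
  have W': "(W has_vector_derivative
      (N *\<^sub>R B - Y + N *\<^sub>R A) * exp (- s *\<^sub>R A) + exp (- s *\<^sub>R A) * (A - X)) (at 0)"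
    unfolding W_def
    by (rule has_vector_derivative_eq_rhs, (rule derivative_intros E)+) (simp add: algebra_simps)
  have ss: "exp (- s *\<^sub>R A) * exp (s *\<^sub>R A) = 1" using exp_scaleR_add[of "-s" A s] by simp
  have As: "exp (- s *\<^sub>R A) * A * exp (s *\<^sub>R A) = A"
  proof -
    have "exp (s *\<^sub>R A) * A = A * exp (s *\<^sub>R A)"
      using exp_times_scaleR_commute by blast
    then show ?thesis using ss by (metis mult.assoc mult_1_left)
  qed
  \<comment> \<open>The derivative of \<open>W\<close>, multiplied by
    \<open>exp (s *\<^sub>R A)\<close>, is the transported first-order error minus \<open>Y\<close>;
    \<open>Y\<close> was chosen to make this vanish.\<close>
  have W0: "((N *\<^sub>R B - Y + N *\<^sub>R A) * exp (- s *\<^sub>R A) + exp (- s *\<^sub>R A) * (A - X)) * exp (s *\<^sub>R A) = 0"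
  proof -
    have "((N *\<^sub>R B - Y + N *\<^sub>R A) * exp (- s *\<^sub>R A) + exp (- s *\<^sub>R A) * (A - X)) * exp (s *\<^sub>R A)
      = (N *\<^sub>R B - Y + N *\<^sub>R A) * (exp (- s *\<^sub>R A) * exp (s *\<^sub>R A))
        + (exp (- s *\<^sub>R A) * A * exp (s *\<^sub>R A) - exp (- s *\<^sub>R A) * X * exp (s *\<^sub>R A))"
      by (simp only: distrib_right left_diff_distrib right_diff_distrib mult.assoc)
    then show ?thesis unfolding ss As by (simp add: Y_def scaleR_add_right)
  qed
  have "(V has_vector_derivative exp (- B) * 
     ((N *\<^sub>R B - Y + N *\<^sub>R A) * exp (- s *\<^sub>R A) + exp (- s *\<^sub>R A) * (A - X)) * (exp (s *\<^sub>R A) * exp B)) (at 0)"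
    unfolding V_eq
    by (rule has_vector_derivative_eq_rhs, (rule derivative_intros W')+) (simp add: algebra_simps)
  moreover have "exp (- B) * 
     ((N *\<^sub>R B - Y + N *\<^sub>R A) * exp (- s *\<^sub>R A) + exp (- s *\<^sub>R A) * (A - X)) * (exp (s *\<^sub>R A) * exp B) = 0"
    using W0 by (simp only: mult.assoc[symmetric] mult_zero_left mult_zero_right)
      (simp only: mult.assoc mult_zero_left mult_zero_right)
  ultimately have V': "(V has_vector_derivative 0) (at 0)" by simp
  have V0: "V 0 = 1"
    using ss exp_minus_inverse[of "-B"] unfolding V_eq W_def
    by (simp add: mult.assoc) (metis mult.assoc mult_1_left)
  \<comment> \<open>The bound g/4 makes the norm of \<open>L\<close> at most half of the gain
    \<open>h * g\<close>; the bound 1/8 keeps \<open>V h\<close> in the domain of the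
    logarithm.\<close>
  define e where "e = min (g / 4) (1/8)"
  have e: "e > 0" using g by (simp add: e_def)
  obtain d where d: "d > 0" "\<And>h. \<bar>h\<bar> < d \<Longrightarrow> norm (V h - 1) \<le> e * \<bar>h\<bar>"
    using V' e V0 unfolding has_vector_derivative_def has_derivative_at_alt by force
  \<comment> \<open>Besides the bound by \<open>d\<close>, these constraints make all coefficients
    in \<open>Xs h\<close> nonnegative, so that the norms of the pieces add up without absolute
    values.\<close>
  define h where "h = min (d / 2) (min 1 (min (1 - s) (min (s / N) (1 / N))))"
  have h: "0 < h" "h < d" "h \<le> 1" "h \<le> 1 - s" "h \<le> s / N" "h \<le> 1 / N"
    using d(1) s divide_pos_pos[OF s(1) N] divide_pos_pos[OF zero_less_one N] unfolding h_def
    by linarith+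
  then have hN: "h * N \<le> s" "h * N \<le> 1" using N by (auto simp: field_simps)
  have Vh: "norm (V h - 1) \<le> e * h" using d(2)[of h] h by simp
  also have "\<dots> \<le> e" using h e by (simp add: mult_le_cancel_left1)
  finally have "norm (V h - 1) \<le> 1/8" by (simp add: e_def)
  then obtain L where L: "exp L = V h" "norm L \<le> 2 * norm (V h - 1)"
    using exists_log_near_one[of "V h - 1"] by auto
  have "norm L \<le> 2 * (e * h)" using L(2) Vh by linarith
  also have "\<dots> \<le> 2 * (g / 4 * h)" using h by (intro mult_left_mono mult_right_mono) (auto simp: e_def)
  finally have nL: "norm L \<le> h * g / 2" by (simp add: mult.commute)
  have inv: "prod_list (map exp (Xs h)) * prod_list (map exp (map uminus (rev (Xs h)))) = 1"
    using prod_list_exp_uminus_rev[of "map uminus (rev (Xs h))"]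
    by (simp add: rev_map comp_def)
  have "prod_list (map exp (Xs h @ [L])) = exp A * exp B"
    using inv by (simp add: L(1) V_def) (metis mult.assoc mult_1_left)
  moreover have "sum_list (map norm (Xs h @ [L])) = norm A + norm B - h * g + norm L"
  proof -
    have "norm ((1 - s - h) *\<^sub>R A) = (1 - s - h) * norm A" "norm ((s - h * N) *\<^sub>R A) = (s - h * N) * norm A"
      "norm ((1 - h * N) *\<^sub>R B) = (1 - h * N) * norm B" "norm (h *\<^sub>R X) = h * norm X" "norm (h *\<^sub>R Y) = h * norm Y"
      using h s hN by simp_all
    then show ?thesis unfolding Xs_def g_def by (simp only: list.map sum_list.Cons sum_list.Nil append.simps) (simp add: algebra_simps)
  qed
  moreover have "norm L < h * g" using nL mult_pos_pos[OF h(1) g] by linarith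
  ultimately show ?thesis unfolding shortcut_def by (intro exI[of _ "Xs h @ [L]"]) simp
qed

section \<open>Matrices with the operator norm as a Banach algebra\<close>

lemma norm_matrix_vector_mult_le:
  fixes A :: "'a::real_normed_field^'n^'m"
  shows "norm (A *v x) \<le> (\<Sum>i\<in>UNIV. \<Sum>j\<in>UNIV. norm (A $ i $ j)) * norm x"
proof -
  have "norm (A *v x) \<le> (\<Sum>i\<in>UNIV. norm ((A *v x) $ i))"
    unfolding norm_vec_def by (intro L2_set_le_sum) auto
  also have "\<dots> \<le> (\<Sum>i\<in>UNIV. \<Sum>j\<in>UNIV. norm (A $ i $ j) * norm x)"
    unfolding matrix_vector_mult_def
    by (intro sum_mono) (auto intro!: sum_norm_le mult_left_mono simp: norm_mult Finite_Cartesian_Product.norm_nth_le)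
  finally show ?thesis by (simp add: sum_distrib_right)
qed

lemma bounded_linear_matrix_vector_mult:
  fixes A :: "'a::real_normed_field^'n^'m"
  shows "bounded_linear ((*v) A)"
  using norm_matrix_vector_mult_le[of A]
  by (intro bounded_linear_intro[where K = "\<Sum>i\<in>UNIV. \<Sum>j\<in>UNIV. norm (A $ i $ j)"])
    (simp_all add: matrix_vector_right_distrib linear_scale[OF matrix_vector_mul_linear] mult.commute)

lemma norm_matrix_vector_mult_le_opnorm:
  fixes A :: "'a::real_normed_field^'n^'n"
  shows "norm (A *v x) \<le> opnorm A * norm x"
  unfolding opnorm_def by (rule onorm[OF bounded_linear_matrix_vector_mult])

lemma opnorm_le_sum_entries:
  fixes A :: "'a::real_normed_field^'n^'n"
  shows "opnorm A \<le> (\<Sum>i\<in>UNIV. \<Sum>j\<in>UNIV. norm (A $ i $ j))"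
  unfolding opnorm_def by (rule onorm_le[OF norm_matrix_vector_mult_le])

lemma norm_axis:
  fixes x :: "'a::real_normed_vector"
  shows "norm (axis i x :: 'a^'n) = norm x"
  by (simp add: norm_vec_def L2_set_def axis_def if_distrib[where f = norm]
      if_distrib[where f = "\<lambda>t. t\<^sup>2"] cong: if_cong)

lemma norm_entry_le_opnorm:
  fixes A :: "'a::real_normed_field^'n^'n"
  shows "norm (A $ i $ j) \<le> opnorm A"
proof -
  have "norm (A $ i $ j) = norm ((A *v axis j 1) $ i)"
    by (simp add: matrix_vector_mult_def axis_def if_distrib cong: if_cong)
  also have "\<dots> \<le> norm (A *v axis j 1)" by (rule Finite_Cartesian_Product.norm_nth_le)
  also have "\<dots> \<le> opnorm A" using norm_matrix_vector_mult_le_opnorm[of A "axis j 1"] by (simp add: norm_axis)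
  finally show ?thesis .
qed

lemma norm_matrix_le_sum_entries:
  fixes A :: "'a::real_normed_field^'n^'m"
  shows "norm A \<le> (\<Sum>i\<in>UNIV. \<Sum>j\<in>UNIV. norm (A $ i $ j))"
proof -
  have "norm A \<le> (\<Sum>i\<in>UNIV. norm (A $ i))" unfolding norm_vec_def by (intro L2_set_le_sum) auto
  also have "\<dots> \<le> (\<Sum>i\<in>UNIV. \<Sum>j\<in>UNIV. norm (A $ i $ j))"
    by (intro sum_mono) (auto simp: norm_vec_def intro!: L2_set_le_sum)
  finally show ?thesis .
qed

text \<open>With \<open>opnorm_le_norm\<close>, this makes the operator norm equivalent to the
  Euclidean norm of the entries. Definiteness, completeness and the sum of the exponential series
  transfer through this equivalence.\<close>

lemma norm_le_opnorm:
  fixes A :: "'a::real_normed_field^'n^'n"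
  shows "norm A \<le> opnorm A * (real CARD('n))\<^sup>2"
proof -
  have "norm A \<le> (\<Sum>i\<in>(UNIV::'n set). \<Sum>j\<in>(UNIV::'n set). opnorm A)"
    by (rule order_trans[OF norm_matrix_le_sum_entries]) (intro sum_mono norm_entry_le_opnorm)
  then show ?thesis by (simp add: power2_eq_square mult_ac)
qed

lemma opnorm_le_norm:
  fixes A :: "'a::real_normed_field^'n^'n"
  shows "opnorm A \<le> norm A * (real CARD('n))\<^sup>2"
proof -
  have "opnorm A \<le> (\<Sum>i\<in>(UNIV::'n set). \<Sum>j\<in>(UNIV::'n set). norm A)"
    by (rule order_trans[OF opnorm_le_sum_entries]) (intro sum_mono, meson Finite_Cartesian_Product.norm_nth_le order_trans)
  then show ?thesis by (simp add: power2_eq_square mult_ac)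
qed

text \<open>Square matrices already carry the Euclidean norm. On this copy the norm is
  \<open>opnorm\<close> and multiplication is \<open>**\<close>, so the Banach algebra results on
  \<open>exp\<close> apply.\<close>

typedef (overloaded) ('a::real_normed_field, 'n::finite) opmat = "UNIV :: ('a^'n^'n) set"
  morphisms mat_of Op ..

setup_lifting type_definition_opmat

instantiation opmat :: (real_normed_field, finite) real_normed_algebra_1
begin

lift_definition zero_opmat :: "('a,'b) opmat" is 0 .
lift_definition one_opmat :: "('a,'b) opmat" is "mat 1" .
lift_definition plus_opmat :: "('a,'b) opmat \<Rightarrow> ('a,'b) opmat \<Rightarrow> ('a,'b) opmat" is "(+)" .
lift_definition minus_opmat :: "('a,'b) opmat \<Rightarrow> ('a,'b) opmat \<Rightarrow> ('a,'b) opmat" is "(-)" .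
lift_definition uminus_opmat :: "('a,'b) opmat \<Rightarrow> ('a,'b) opmat" is "uminus" .
lift_definition times_opmat :: "('a,'b) opmat \<Rightarrow> ('a,'b) opmat \<Rightarrow> ('a,'b) opmat" is "(**)" .
lift_definition scaleR_opmat :: "real \<Rightarrow> ('a,'b) opmat \<Rightarrow> ('a,'b) opmat" is "(*\<^sub>R)" .
lift_definition norm_opmat :: "('a,'b) opmat \<Rightarrow> real" is opnorm .
definition dist_opmat :: "('a,'b) opmat \<Rightarrow> ('a,'b) opmat \<Rightarrow> real" where "dist_opmat X Y = norm (X - Y)"
definition sgn_opmat :: "('a,'b) opmat \<Rightarrow> ('a,'b) opmat" where "sgn_opmat X = inverse (norm X) *\<^sub>R X"
definition uniformity_opmat :: "(('a,'b) opmat \<times> ('a,'b) opmat) filter" where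
  "uniformity_opmat = (INF e\<in>{0<..}. principal {(x, y). dist x y < e})"
definition open_opmat :: "('a,'b) opmat set \<Rightarrow> bool" where
  "open_opmat U \<longleftrightarrow> (\<forall>x\<in>U. \<forall>\<^sub>F (x', y) in uniformity. x' = x \<longrightarrow> y \<in> U)"

instance
proof
  fix X Y Z :: "('a,'b) opmat" and a b :: real
  show "X * Y * Z = X * (Y * Z)" by transfer (simp add: matrix_mul_assoc)
  show "(X + Y) * Z = X * Z + Y * Z" by transfer (simp add: matrix_matrix_mult_def vec_eq_iff distrib_right sum.distrib)
  show "X * (Y + Z) = X * Y + X * Z" by transfer (simp add: matrix_add_ldistrib)
  show "1 * X = X" "X * 1 = X" by (transfer, simp)+
  show "(0::('a,'b) opmat) \<noteq> 1" by transfer (auto simp: mat_def vec_eq_iff)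
  show "(a *\<^sub>R X) * Y = a *\<^sub>R (X * Y)" by transfer (simp add: scalar_matrix_assoc)
  show "X * (a *\<^sub>R Y) = a *\<^sub>R (X * Y)" by transfer (simp add: matrix_scalar_ac scalar_matrix_assoc)
  show "norm X = 0 \<longleftrightarrow> X = 0"
  proof transfer
    fix A :: "'a^'b^'b"
    show "opnorm A = 0 \<longleftrightarrow> A = 0"
      using norm_le_opnorm[of A] opnorm_le_norm[of A] by (auto simp: opnorm_def onorm_zero)
  qed
  show "norm (X + Y) \<le> norm X + norm Y"
    by transfer (auto simp: opnorm_def matrix_vector_mult_add_rdistrib
        intro!: onorm_triangle bounded_linear_matrix_vector_mult)
  show "norm (a *\<^sub>R X) = \<bar>a\<bar> * norm X"
  proof transfer
    fix a and A :: "'a^'b^'b"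
    have "(\<lambda>x. (a *\<^sub>R A) *v x) = (\<lambda>x. a *\<^sub>R (A *v x))"
      by (auto simp: matrix_vector_mult_def vec_eq_iff scaleR_sum_right)
    then show "opnorm (a *\<^sub>R A) = \<bar>a\<bar> * opnorm A"
      unfolding opnorm_def by (simp add: onorm_scaleR[OF bounded_linear_matrix_vector_mult])
  qed
  show "norm (X * Y) \<le> norm X * norm Y"
  proof transfer
    fix A B :: "'a^'b^'b"
    show "opnorm (A ** B) \<le> opnorm A * opnorm B"
      using onorm_compose[OF bounded_linear_matrix_vector_mult[of A] bounded_linear_matrix_vector_mult[of B]]
      by (simp add: opnorm_def comp_def matrix_vector_mul_assoc)
  qed
  show "norm (1::('a,'b) opmat) = 1"
  proof transfer
    show "opnorm (mat 1 :: 'a^'b^'b) = 1"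
    proof (rule antisym)
      show "opnorm (mat 1 :: 'a^'b^'b) \<le> 1" unfolding opnorm_def by (rule onorm_le) simp
      show "1 \<le> opnorm (mat 1 :: 'a^'b^'b)"
        using norm_matrix_vector_mult_le_opnorm[of "mat 1 :: 'a^'b^'b" "axis undefined 1"]
        by (simp add: norm_axis)
    qed
  qed
  show "X + Y + Z = X + (Y + Z)" "X + Y = Y + X" "0 + X = X" "- X + X = 0" "X - Y = X + - Y"
    "a *\<^sub>R (X + Y) = a *\<^sub>R X + a *\<^sub>R Y" "(a + b) *\<^sub>R X = a *\<^sub>R X + b *\<^sub>R X"
    "a *\<^sub>R b *\<^sub>R X = (a * b) *\<^sub>R X" "1 *\<^sub>R X = X"
    by (transfer, simp add: algebra_simps)+
qed (fact dist_opmat_def sgn_opmat_def uniformity_opmat_def open_opmat_def)+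

end

lemma bounded_linear_mat_of: "bounded_linear (mat_of :: ('a::real_normed_field,'n::finite) opmat \<Rightarrow> _)"
proof (rule bounded_linear_intro)
  show "norm (mat_of X) \<le> norm X * (real CARD('n))\<^sup>2" for X :: "('a,'n) opmat"
    by transfer (rule norm_le_opnorm)
qed (transfer; simp)+

instance opmat :: ("{real_normed_field,banach}", finite) banach
proof
  fix X :: "nat \<Rightarrow> ('a,'b) opmat"
  assume "Cauchy X"
  then have "Cauchy (\<lambda>n. mat_of (X n))"
    by (rule bounded_linear.Cauchy[OF bounded_linear_mat_of])
  then obtain L where "(\<lambda>n. mat_of (X n)) \<longlonglongrightarrow> L"
    by (auto simp: Cauchy_convergent_iff convergent_def)
  then have "(\<lambda>n. norm (mat_of (X n) - L) * (real CARD('b))\<^sup>2) \<longlonglongrightarrow> 0"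
    by (intro tendsto_mult_left_zero tendsto_norm_zero) (simp add: LIM_zero_iff)
  moreover have "norm (X n - Op L) \<le> norm (mat_of (X n) - L) * (real CARD('b))\<^sup>2" for n
    using opnorm_le_norm[of "mat_of (X n) - L"] by (simp add: norm_opmat.rep_eq minus_opmat.rep_eq Op_inverse)
  ultimately have "(\<lambda>n. X n - Op L) \<longlonglongrightarrow> 0"
    by (rule Lim_null_comparison[OF always_eventually, OF allI, rotated])
  then show "convergent X" by (auto simp: convergent_def LIM_zero_iff)
qed

section \<open>Matrix exponentials and the Magnus exponent in terms of the Banach algebra\<close>

lemma mpow_eq: "mpow A k = mat_of (Op A ^ k)"
  by (induction k) (simp_all add: one_opmat.rep_eq times_opmat.rep_eq Op_inverse)

text \<open>The two series converge in different norms; the bounded linear map \<open>mat_of\<close>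
  carries one sum to the other.\<close>

lemma mexp_eq: "mexp A = mat_of (exp (Op A))"
  unfolding mexp_def exp_def mpow_eq bounded_linear.suminf[OF bounded_linear_mat_of summable_exp_generic]
  by (simp add: scaleR_opmat.rep_eq inverse_eq_divide)

lemma exp_prod_eq: "exp_prod Bs = mat_of (prod_list (map exp (rev (map Op Bs))))"
  unfolding exp_prod_def
  by (induction Bs) (simp_all add: one_opmat.rep_eq times_opmat.rep_eq mexp_eq)

lemma opnorm_nonneg: "0 \<le> opnorm (A :: 'a::{real_normed_field,banach}^'n^'n)"
  unfolding opnorm_def by (rule onorm_pos_le[OF bounded_linear_matrix_vector_mult])

lemma shortcut_imp_magnus_less:
  fixes A B :: "'a::{real_normed_field,banach}^'n^'n"
  assumes "shortcut (Op A) (Op B)"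
  shows "magnus (mexp A ** mexp B) < opnorm A + opnorm B"
proof -
  obtain Xs where Xs: "Xs \<noteq> []" "prod_list (map exp Xs) = exp (Op A) * exp (Op B)"
    "sum_list (map norm Xs) < norm (Op A) + norm (Op B)" using assms unfolding shortcut_def by blast
  let ?Bs = "rev (map mat_of Xs)"
  have "magnus (mexp A ** mexp B) \<le> sum_list (map opnorm ?Bs)"
    unfolding magnus_def
  proof (rule cInf_lower)
    show "bdd_below {sum_list (map opnorm Bs) |Bs. Bs \<noteq> [] \<and> exp_prod Bs = mexp A ** mexp B}"
      by (rule bdd_belowI[of _ 0]) (auto intro!: sum_list_nonneg opnorm_nonneg)
    have "exp_prod ?Bs = mexp A ** mexp B"
      using Xs(2) by (simp add: exp_prod_eq mexp_eq times_opmat.rep_eq rev_map comp_def mat_of_inverse)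
    then show "sum_list (map opnorm ?Bs) \<in> {sum_list (map opnorm Bs) |Bs. Bs \<noteq> [] \<and> exp_prod Bs = mexp A ** mexp B}"
      using Xs(1) by blast
  qed
  also have "sum_list (map opnorm ?Bs) = sum_list (map norm Xs)"
    by (simp add: norm_opmat.rep_eq[abs_def] comp_def flip: rev_map)
  finally show ?thesis using Xs(3) by (simp add: norm_opmat.rep_eq Op_inverse)
qed

section \<open>Transfer of needle variations\<close>

text \<open>Multiplicativity is asked only on powers of the single element \<open>x\<close>, so the
  order-reversing map \<open>adj\<close> is covered as well.\<close>

lemma exp_power_morphism:
  fixes f :: "'b::{real_normed_algebra_1,banach} \<Rightarrow> 'c::{real_normed_algebra_1,banach}"
  assumes "bounded_linear f" "\<And>n. f (x ^ n) = f x ^ n"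
  shows "f (exp x) = exp (f x)"
  unfolding exp_def bounded_linear.suminf[OF assms(1) summable_exp_generic]
  by (simp add: linear_scale[OF bounded_linear.linear[OF assms(1)]] assms(2))

text \<open>Here \<open>f\<close> embeds a smaller algebra, and \<open>g\<close> is a contractive
  retraction that respects multiplication by the image of \<open>f\<close> on both sides. Hence
  \<open>g\<close> maps the closing term for \<open>X\<close> to the closing term for
  \<open>g X\<close> and increases neither norm. Unitary conjugation and the passage from complex to
  real matrices are both instances.\<close>

lemma needle_retract:
  fixes f :: "'b::{real_normed_algebra_1,banach} \<Rightarrow> 'c::{real_normed_algebra_1,banach}"
    and g :: "'c \<Rightarrow> 'b"
  assumes f: "linear f" "\<And>x. norm (f x) \<le> norm x" "\<And>x y. f (x * y) = f x * f y" "f 1 = 1"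
    and g: "linear g" "\<And>y. norm (g y) \<le> norm y" "\<And>a b y. g (f a * y * f b) = a * g y * b"
      "\<And>a. g (f a) = a"
    and "needle (f A) (f B)"
  shows "needle A B"
proof -
  have bl: "bounded_linear f"
    using f(2) by (intro bounded_linear_intro[where K = 1]) (simp_all add: linear_add[OF f(1)] linear_scale[OF f(1)])
  have "f (x ^ n) = f x ^ n" for x n by (induction n) (simp_all add: f)
  then have ef: "f (exp x) = exp (f x)" for x by (rule exp_power_morphism[OF bl])
  from assms obtain s N X where s: "0 < s" "s < 1" and N: "0 < N" and
    less: "norm X + norm (N *\<^sub>R (f A + f B) + f A - exp (- s *\<^sub>R f A) * X * exp (s *\<^sub>R f A))
       < norm (f A) + N * (norm (f A) + norm (f B))" unfolding needle_def by blast
  have "N *\<^sub>R (A + B) + A - exp (- s *\<^sub>R A) * g X * exp (s *\<^sub>R A) =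
      g (N *\<^sub>R (f A + f B) + f A - exp (- s *\<^sub>R f A) * X * exp (s *\<^sub>R f A))"
    using g(3)[of "exp (- s *\<^sub>R A)" X "exp (s *\<^sub>R A)"]
    by (simp add: ef linear_add[OF g(1)] linear_diff[OF g(1)] linear_scale[OF g(1)] linear_scale[OF f(1)]
        linear_neg[OF f(1)] g(4))
  then have "norm (g X) + norm (N *\<^sub>R (A + B) + A - exp (- s *\<^sub>R A) * g X * exp (s *\<^sub>R A))
      < norm (f A) + N * (norm (f A) + norm (f B))"
    using less g(2)[of X] g(2)[of "N *\<^sub>R (f A + f B) + f A - exp (- s *\<^sub>R f A) * X * exp (s *\<^sub>R f A)"]
    by simp
  also have "\<dots> \<le> norm A + N * (norm A + norm B)"
    using f(2) N by (intro add_mono mult_left_mono) auto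
  finally show ?thesis unfolding needle_def using s N by blast
qed

lemma needle_conj:
  fixes u v :: "'b::{real_normed_algebra_1,banach}"
  assumes uv: "u * v = 1" "v * u = 1" "norm u \<le> 1" "norm v \<le> 1" and "needle (u * A * v) (u * B * v)"
  shows "needle A B"
proof (rule needle_retract[where f = "\<lambda>x. u * x * v" and g = "\<lambda>x. v * x * u"])
  have n: "norm (a * x * b) \<le> norm x" if "norm a \<le> 1" "norm b \<le> 1" for a b x :: 'b
  proof -
    have "norm (a * x * b) \<le> norm a * norm x * norm b"
      by (meson norm_mult_ineq mult_right_mono norm_ge_zero order_trans)
    also have "\<dots> \<le> 1 * norm x * 1" using that by (intro mult_mono) auto
    finally show ?thesis by simp
  qed
  show "norm (u * x * v) \<le> norm x" "norm (v * x * u) \<le> norm x" for x using uv n by auto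
  show "linear (\<lambda>x. u * x * v)" "linear (\<lambda>x. v * x * u)"
    by (auto intro!: linearI simp: algebra_simps)
  have [simp]: "u * (v * z) = z" "v * (u * z) = z" for z using uv by (simp_all flip: mult.assoc)
  show "u * (x * y) * v = u * x * v * (u * y * v)" for x y by (simp add: mult.assoc)
  show "u * 1 * v = 1" using uv by simp
  show "v * (u * a * v * y * (u * b * v)) * u = a * (v * y * u) * b" for a b y
    by (simp add: mult.assoc uv)
  show "v * (u * a * v) * u = a" for a by (simp add: mult.assoc uv)
qed fact

section \<open>Real matrices inside complex matrices\<close>

lemma norm_complex_vec_squared:
  fixes w :: "complex^'n"
  shows "(norm w)\<^sup>2 = (norm (\<chi> i. Re (w $ i)))\<^sup>2 + (norm (\<chi> i. Im (w $ i)))\<^sup>2"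
  by (simp add: norm_vec_def L2_set_def sum_nonneg cmod_power2 sum.distrib)

lemma opnorm_le:
  fixes A :: "'a::real_normed_field^'n^'n"
  assumes "\<And>x. norm (A *v x) \<le> b * norm x"
  shows "opnorm A \<le> b"
  unfolding opnorm_def by (rule onorm_le[OF assms])

lift_definition op_of_real :: "(real, 'n::finite) opmat \<Rightarrow> (complex, 'n) opmat" is cplx .
lift_definition op_Re :: "(complex, 'n::finite) opmat \<Rightarrow> (real, 'n) opmat" is "map_matrix Re" .

text \<open>A real matrix acts separately on the real and imaginary parts of a vector, and the
  squared norms of the parts add up.\<close>

lemma norm_op_of_real: "norm (op_of_real X) \<le> norm X"
proof transfer
  fix A :: "real^'n^'n"
  show "opnorm (cplx A) \<le> opnorm A"
  proof (rule opnorm_le)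
    fix w :: "complex^'n"
    let ?r = "\<chi> i. Re (w $ i)" and ?i = "\<chi> i. Im (w $ i)"
    have "(\<chi> i. Re ((cplx A *v w) $ i)) = A *v ?r" "(\<chi> i. Im ((cplx A *v w) $ i)) = A *v ?i"
      by (simp_all add: vec_eq_iff cplx_def matrix_vector_mult_def map_matrix_def)
    then have "(norm (cplx A *v w))\<^sup>2 = (norm (A *v ?r))\<^sup>2 + (norm (A *v ?i))\<^sup>2"
      by (simp add: norm_complex_vec_squared)
    also have "\<dots> \<le> (opnorm A * norm ?r)\<^sup>2 + (opnorm A * norm ?i)\<^sup>2"
      by (intro add_mono power_mono norm_matrix_vector_mult_le_opnorm) auto
    also have "\<dots> = (opnorm A * norm w)\<^sup>2"
      by (simp add: norm_complex_vec_squared[of w] power_mult_distrib distrib_left)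
    finally show "norm (cplx A *v w) \<le> opnorm A * norm w"
      using opnorm_nonneg[of A] by (meson mult_nonneg_nonneg norm_ge_zero power2_le_imp_le)
  qed
qed

text \<open>On a real vector \<open>v\<close>, the entrywise real part of \<open>A\<close> yields
  the real part of \<open>A\<close> applied to \<open>v\<close>.\<close>

lemma norm_op_Re: "norm (op_Re X) \<le> norm X"
proof transfer
  fix A :: "complex^'n^'n"
  show "opnorm (map_matrix Re A) \<le> opnorm A"
  proof (rule opnorm_le)
    fix v :: "real^'n"
    let ?w = "\<chi> i. complex_of_real (v $ i)"
    have "map_matrix Re A *v v = (\<chi> i. Re ((A *v ?w) $ i))"
      by (simp add: vec_eq_iff matrix_vector_mult_def map_matrix_def)
    then have "(norm (map_matrix Re A *v v))\<^sup>2 \<le> (norm (A *v ?w))\<^sup>2"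
      by (simp add: norm_complex_vec_squared[of "A *v ?w"])
    then have "norm (map_matrix Re A *v v) \<le> norm (A *v ?w)" by (rule power2_le_imp_le) simp
    also have "\<dots> \<le> opnorm A * norm ?w" by (rule norm_matrix_vector_mult_le_opnorm)
    also have "norm ?w = norm v" by (simp add: norm_vec_def)
    finally show "norm (map_matrix Re A *v v) \<le> opnorm A * norm v" .
  qed
qed

lemma needle_op_of_real:
  fixes A B :: "(real, 'n::finite) opmat"
  assumes "needle (op_of_real A) (op_of_real B)"
  shows "needle A B"
proof (rule needle_retract[where f = op_of_real and g = op_Re, OF _ norm_op_of_real _ _ _ norm_op_Re])
  show "linear (op_of_real :: (real,'n) opmat \<Rightarrow> _)"
    by (rule linearI; transfer) (simp_all add: vec_eq_iff cplx_def map_matrix_def complex_eq_iff)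
  show "linear (op_Re :: (complex,'n) opmat \<Rightarrow> _)"
    by (rule linearI; transfer) (simp_all add: vec_eq_iff map_matrix_def)
  show "op_of_real (X * Y) = op_of_real X * op_of_real Y" for X Y :: "(real,'n) opmat"
    by transfer (simp add: vec_eq_iff cplx_def map_matrix_def matrix_matrix_mult_def)
  show "op_of_real 1 = (1 :: (complex,'n) opmat)"
    by transfer (simp add: vec_eq_iff cplx_def map_matrix_def mat_def)
  show "op_Re (op_of_real X * Y * op_of_real Z) = X * op_Re Y * Z" for X Z :: "(real,'n) opmat" and Y
    by transfer (simp add: vec_eq_iff cplx_def map_matrix_def matrix_matrix_mult_def)
  show "op_Re (op_of_real X) = X" for X :: "(real,'n) opmat"
    by transfer (simp add: vec_eq_iff cplx_def map_matrix_def)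
qed fact

section \<open>Adjoints and perturbation of the operator norm\<close>

lift_definition adj :: "(complex, 'n::finite) opmat \<Rightarrow> (complex, 'n) opmat" is cadj .

lemma cadj_nth: "cadj A $ i $ j = cnj (A $ j $ i)"
  by (simp add: cadj_def transpose_def)

lemma adj_mult: "adj (X * Y) = adj Y * adj X"
  by transfer (simp add: vec_eq_iff cadj_nth matrix_matrix_mult_def mult.commute)

lemma adj_one: "adj 1 = 1"
  by transfer (simp add: vec_eq_iff cadj_nth mat_def eq_commute)

lemma adj_scaleR: "adj (a *\<^sub>R X) = a *\<^sub>R adj X"
  by transfer (simp add: vec_eq_iff cadj_nth)

text \<open>Only continuity is wanted, to pull \<open>adj\<close> through the exponential series; a
  crude entrywise constant suffices.\<close>

lemma bounded_linear_adj: "bounded_linear (adj :: (complex, 'n::finite) opmat \<Rightarrow> _)"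
proof (rule bounded_linear_intro)
  show "adj (X + Y) = adj X + adj Y" for X Y :: "(complex, 'n) opmat"
    by transfer (simp add: vec_eq_iff cadj_nth)
  show "norm (adj X) \<le> norm X * (real CARD('n))\<^sup>2" for X :: "(complex, 'n) opmat"
  proof transfer
    fix A :: "complex^'n^'n"
    have "opnorm (cadj A) \<le> (\<Sum>i\<in>(UNIV::'n set). \<Sum>j\<in>(UNIV::'n set). opnorm A)"
      by (rule order_trans[OF opnorm_le_sum_entries])
        (intro sum_mono, simp add: cadj_nth norm_entry_le_opnorm)
    then show "opnorm (cadj A) \<le> opnorm A * (real CARD('n))\<^sup>2" by (simp add: power2_eq_square mult_ac)
  qed
qed (rule adj_scaleR)

lemma adj_exp: "adj (exp X) = exp (adj X)"
proof (rule exp_power_morphism[OF bounded_linear_adj])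
  show "adj (X ^ n) = adj X ^ n" for n by (induction n) (simp_all add: adj_one adj_mult power_commutes)
qed

text \<open>The inner product of complex vectors is here the real one, that is, the real part of the
  Hermitian product.\<close>

lemma inner_adj: "(mat_of X *v w) \<bullet> z = w \<bullet> (mat_of (adj X) *v z)"
proof -
  have "(A *v w) \<bullet> z = w \<bullet> (cadj A *v z)" for A
  proof -
    have inner: "x \<bullet> y = Re (cnj x * y)" for x y by (simp add: inner_complex_def)
    have "(A *v w) \<bullet> z = Re (\<Sum>i\<in>UNIV. \<Sum>j\<in>UNIV. cnj (A $ i $ j * w $ j) * z $ i)"
      by (simp only: inner_vec_def inner matrix_vector_mult_def cnj_sum sum_distrib_right Re_sum vec_lambda_beta)
    also have "\<dots> = Re (\<Sum>j\<in>UNIV. \<Sum>i\<in>UNIV. cnj (A $ i $ j * w $ j) * z $ i)"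
      by (subst sum.swap) simp
    also have "\<dots> = w \<bullet> (cadj A *v z)"
      by (simp only: inner_vec_def inner matrix_vector_mult_def sum_distrib_left Re_sum vec_lambda_beta
          cadj_nth complex_cnj_mult mult_ac)
    finally show ?thesis .
  qed
  then show ?thesis by (simp add: adj.rep_eq)
qed

lemma mat_of_mult_vec: "mat_of (X * Y) *v w = mat_of X *v (mat_of Y *v w)"
  by (simp add: times_opmat.rep_eq matrix_vector_mul_assoc)

lemma norm_vec2: "(norm (w :: complex^2))\<^sup>2 = (cmod (w$1))\<^sup>2 + (cmod (w$2))\<^sup>2"
  by (simp add: norm_vec_def L2_set_def sum_2)

lemma norm_vector_scalar_mult:
  fixes w :: "'a::real_normed_field^'n"
  shows "norm (c *s w) = norm c * norm w"
  by (simp add: norm_vec_def L2_set_def norm_mult power_mult_distrib sum_distrib_left[symmetric] real_sqrt_mult)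

lemma mat_mult_axis_decomp:
  fixes M :: "complex^2^2"
  shows "M *v w = w$1 *s (M *v axis 1 1) + w$2 *s (M *v axis 2 1)"
  by (simp add: vec_eq_iff matrix_vector_mult_def sum_2 axis_def algebra_simps)

text \<open>The singular values of \<open>M\<close> are \<sigma> and m < \<sigma>, and the top one
  is attained only along the first axis. A perturbation that decreases the norm there to first order
  therefore decreases the operator norm; the gap \<kappa> absorbs the mixed terms in other
  directions.\<close>

lemma opnorm_perturb_less:
  fixes M D :: "complex^2^2"
  assumes \<sigma>: "\<sigma> > 0" and m: "0 \<le> m" "m < \<sigma>" and u: "norm u = 1"
    and M1: "M *v axis 1 1 = \<sigma> *\<^sub>R u"
    and M2: "\<And>w. (norm (M *v w))\<^sup>2 = \<sigma>\<^sup>2 * (cmod (w$1))\<^sup>2 + m\<^sup>2 * (cmod (w$2))\<^sup>2"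
    and D: "u \<bullet> (D *v axis 1 1) < 0"
  shows "\<exists>\<epsilon>>0. opnorm (M + \<epsilon> *\<^sub>R D) < \<sigma>"
proof -
  define \<rho> where "\<rho> = - (u \<bullet> (D *v axis 1 1))"
  define K where "K = opnorm D"
  define \<kappa> where "\<kappa> = \<sigma>\<^sup>2 - m\<^sup>2"
  have \<rho>: "\<rho> > 0" using D by (simp add: \<rho>_def)
  have K: "K \<ge> 0" by (simp add: K_def opnorm_nonneg)
  have \<kappa>: "\<kappa> > 0" using m by (simp add: \<kappa>_def power_strict_mono)
  \<comment> \<open>\<open>L\<close> collects the coefficients of \<epsilon> squared: one from the
    squared norm of \<open>D *v w\<close>, one from completing the square below, and 1 to keep it
    positive.\<close>
  define L where "L = K\<^sup>2 + 8 * \<sigma>\<^sup>2 * K\<^sup>2 / \<kappa> + 1"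
  have L: "L > 0" using \<kappa> by (auto simp: L_def intro!: add_nonneg_pos)
  \<comment> \<open>The three bounds, in order: half of the gap \<kappa> survives, the quadratic
    terms eat at most half of the linear gain, and \<open>c\<close> stays nonnegative.\<close>
  define \<epsilon> where "\<epsilon> = min (\<kappa> / (4 * \<sigma> * \<rho>)) (min (\<sigma> * \<rho> / L) (\<sigma> / (2 * \<rho>)))"
  have \<epsilon>: "\<epsilon> > 0" using \<kappa> \<sigma> \<rho> L by (simp add: \<epsilon>_def)
  have e1: "\<epsilon> * (2 * \<sigma> * \<rho>) \<le> \<kappa> / 2"
  proof -
    have "\<epsilon> \<le> \<kappa> / (4 * \<sigma> * \<rho>)" by (simp add: \<epsilon>_def)
    then show ?thesis using \<sigma> \<rho> by (simp add: field_simps)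
  qed
  have e2: "\<epsilon> * L \<le> \<sigma> * \<rho>"
  proof -
    have "\<epsilon> \<le> \<sigma> * \<rho> / L" by (simp add: \<epsilon>_def)
    then show ?thesis using L by (simp add: field_simps)
  qed
  have e3: "\<epsilon> * \<rho> \<le> \<sigma> / 2"
  proof -
    have "\<epsilon> \<le> \<sigma> / (2 * \<rho>)" by (simp add: \<epsilon>_def)
    then show ?thesis using \<rho> by (simp add: field_simps)
  qed
  define c where "c = \<sigma>\<^sup>2 - \<epsilon> * \<sigma> * \<rho>"
  have c: "0 \<le> c" "c < \<sigma>\<^sup>2"
    using e3 \<sigma> \<epsilon> \<rho> mult_left_mono[OF e3, of \<sigma>] by (auto simp: c_def power2_eq_square algebra_simps)
  have bound: "(norm ((M + \<epsilon> *\<^sub>R D) *v w))\<^sup>2 \<le> c * (norm w)\<^sup>2" for w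
  proof -
    define a b n where "a = cmod (w$1)" and "b = cmod (w$2)" and "n = norm w"
    have n2: "n\<^sup>2 = a\<^sup>2 + b\<^sup>2" by (simp add: n_def a_def b_def norm_vec2)
    have pos: "0 \<le> a" "0 \<le> b" "0 \<le> n" by (simp_all add: a_def b_def n_def)
    have "a \<le> n" unfolding a_def n_def by (rule Finite_Cartesian_Product.norm_nth_le)
    have D1: "norm (D *v v) \<le> K * norm v" for v unfolding K_def by (rule norm_matrix_vector_mult_le_opnorm)
    let ?x1 = "w$1 *s (M *v axis 1 1)" and ?x2 = "w$2 *s (M *v axis 2 1)"
    let ?y1 = "w$1 *s (D *v axis 1 1)" and ?y2 = "w$2 *s (D *v axis 2 1)"
    have nx1: "norm ?x1 = \<sigma> * a" using \<sigma> by (simp add: M1 norm_vector_scalar_mult u a_def mult.commute)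
    have "(norm (M *v axis 2 1))\<^sup>2 = m\<^sup>2" using M2[of "axis 2 1"] by (simp add: axis_def)
    then have "norm (M *v axis 2 1) = m" using m by (metis norm_ge_zero power2_eq_imp_eq)
    then have nx2: "norm ?x2 = m * b" by (simp add: norm_vector_scalar_mult b_def mult.commute)
    have ny2: "norm ?y2 \<le> K * b"
      using D1[of "axis 2 1"] by (simp add: norm_vector_scalar_mult b_def norm_axis mult.commute[of K] mult_left_mono)
    have i1: "?x1 \<bullet> ?y1 = - (a\<^sup>2 * \<sigma> * \<rho>)"
      unfolding M1 \<rho>_def a_def
      by (simp add: inner_vec_def inner_complex_def sum_2 cmod_power2) (simp add: algebra_simps power2_eq_square)
    have i2: "?x1 \<bullet> ?y2 \<le> \<sigma> * n * (K * b)"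
    proof -
      have "?x1 \<bullet> ?y2 \<le> norm ?x1 * norm ?y2" by (rule norm_cauchy_schwarz)
      also have "\<dots> \<le> (\<sigma> * n) * (K * b)"
        unfolding nx1 using ny2 \<open>a \<le> n\<close> \<sigma> K pos by (intro mult_mono) auto
      finally show ?thesis .
    qed
    have i3: "?x2 \<bullet> (D *v w) \<le> \<sigma> * b * (K * n)"
    proof -
      have "?x2 \<bullet> (D *v w) \<le> norm ?x2 * norm (D *v w)" by (rule norm_cauchy_schwarz)
      also have "\<dots> \<le> (\<sigma> * b) * (K * n)"
        unfolding nx2 using D1[of w] m \<sigma> K pos by (intro mult_mono mult_right_mono) (auto simp: n_def)
      finally show ?thesis .
    qed
    \<comment> \<open>Every term but the product of \<open>?x1\<close> and \<open>?y1\<close>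
      carries a factor \<open>b\<close>, the size of the component off the maximizing axis.\<close>
    have "(M *v w) \<bullet> (D *v w) = ?x1 \<bullet> (?y1 + ?y2) + ?x2 \<bullet> (D *v w)"
      by (metis mat_mult_axis_decomp[of M w] mat_mult_axis_decomp[of D w] inner_add_left)
    then have ip: "(M *v w) \<bullet> (D *v w) \<le> - (a\<^sup>2 * \<sigma> * \<rho>) + 2 * \<sigma> * K * b * n"
      using i1 i2 i3 by (simp add: inner_add_right algebra_simps)
    have "(\<epsilon> *\<^sub>R D) *v w = \<epsilon> *\<^sub>R (D *v w)"
      by (simp add: vec_eq_iff matrix_vector_mult_def scaleR_sum_right)
    then have "(M + \<epsilon> *\<^sub>R D) *v w = M *v w + \<epsilon> *\<^sub>R (D *v w)"
      by (simp add: matrix_vector_mult_add_rdistrib)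
    then have "(norm ((M + \<epsilon> *\<^sub>R D) *v w))\<^sup>2 =
        (norm (M *v w))\<^sup>2 + 2 * \<epsilon> * ((M *v w) \<bullet> (D *v w)) + \<epsilon>\<^sup>2 * (norm (D *v w))\<^sup>2"
      unfolding power2_norm_eq_inner
      by (simp add: inner_add_left inner_add_right inner_commute[of "D *v w" "M *v w"] power2_eq_square algebra_simps)
    also have "\<dots> \<le> (\<sigma>\<^sup>2 * a\<^sup>2 + m\<^sup>2 * b\<^sup>2) + 2 * \<epsilon> * (- (a\<^sup>2 * \<sigma> * \<rho>) + 2 * \<sigma> * K * b * n) + \<epsilon>\<^sup>2 * (K * n)\<^sup>2"
      using ip \<epsilon> pos D1[of w] unfolding M2 a_def[symmetric] b_def[symmetric] n_def[symmetric]
      by (intro add_mono mult_left_mono power_mono) auto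
    also have "\<dots> = \<sigma>\<^sup>2 * n\<^sup>2 - 2 * \<epsilon> * \<sigma> * \<rho> * n\<^sup>2 + \<epsilon>\<^sup>2 * K\<^sup>2 * n\<^sup>2
        + (\<epsilon> * (2 * \<sigma> * \<rho>) - \<kappa>) * b\<^sup>2 + 4 * \<epsilon> * \<sigma> * K * b * n"
      unfolding n2 \<kappa>_def power_mult_distrib by (simp add: algebra_simps)
    also have "\<dots> \<le> \<sigma>\<^sup>2 * n\<^sup>2 - 2 * \<epsilon> * \<sigma> * \<rho> * n\<^sup>2 + \<epsilon>\<^sup>2 * K\<^sup>2 * n\<^sup>2 + (- (\<kappa> / 2)) * b\<^sup>2 + 4 * \<epsilon> * \<sigma> * K * b * n"
      using e1 \<epsilon> \<sigma> K pos by (intro add_mono mult_right_mono) auto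
    also have "\<dots> \<le> \<sigma>\<^sup>2 * n\<^sup>2 - 2 * \<epsilon> * \<sigma> * \<rho> * n\<^sup>2 + \<epsilon>\<^sup>2 * K\<^sup>2 * n\<^sup>2 + 8 * \<epsilon>\<^sup>2 * \<sigma>\<^sup>2 * K\<^sup>2 / \<kappa> * n\<^sup>2"
    proof -
      \<comment> \<open>Completing the square plays the remaining gap term in \<open>b\<close>
        against the mixed term in \<open>b * n\<close>.\<close>
      have "0 \<le> (\<kappa> * b - 4 * \<epsilon> * \<sigma> * K * n)\<^sup>2 / (2 * \<kappa>)" using \<kappa> by simp
      also have "\<dots> = \<kappa> / 2 * b\<^sup>2 - 4 * \<epsilon> * \<sigma> * K * b * n + 8 * \<epsilon>\<^sup>2 * \<sigma>\<^sup>2 * K\<^sup>2 / \<kappa> * n\<^sup>2"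
        using \<kappa> by (simp add: field_simps power2_eq_square)
      finally show ?thesis by simp
    qed
    also have "\<dots> = \<sigma>\<^sup>2 * n\<^sup>2 - 2 * \<epsilon> * \<sigma> * \<rho> * n\<^sup>2 + \<epsilon> * (\<epsilon> * (L - 1)) * n\<^sup>2"
      by (simp add: L_def algebra_simps power2_eq_square)
    also have "\<dots> \<le> \<sigma>\<^sup>2 * n\<^sup>2 - 2 * \<epsilon> * \<sigma> * \<rho> * n\<^sup>2 + \<epsilon> * (\<sigma> * \<rho>) * n\<^sup>2"
      using e2 \<epsilon> by (intro add_left_mono mult_right_mono mult_left_mono) (auto simp: algebra_simps)
    finally show ?thesis by (simp add: c_def n_def algebra_simps)
  qed
  have "norm ((M + \<epsilon> *\<^sub>R D) *v w) \<le> sqrt c * norm w" for w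
    using real_sqrt_le_mono[OF bound[of w]] by (simp add: real_sqrt_mult)
  then have "opnorm (M + \<epsilon> *\<^sub>R D) \<le> sqrt c" by (rule opnorm_le)
  also have "\<dots> < \<sigma>" using c \<sigma> by (metis less_eq_real_def real_sqrt_less_iff real_sqrt_abs abs_of_pos)
  finally show ?thesis using \<epsilon> by blast
qed

section \<open>Skew-aligned pairs\<close>

text \<open>The off-diagonal entry vanishes at \<open>s = 0\<close>, and its derivative there is the
  entry of \<open>adj X + X\<close>. If it vanished on a right neighbourhood of 0, that derivative
  would be 0.\<close>

lemma exists_entry_nonzero:
  fixes X :: "(complex, 2) opmat"
  assumes "mat_of (adj X + X) $ 2 $ 1 \<noteq> 0"
  shows "\<exists>s>0. s < 1 \<and> mat_of (exp (s *\<^sub>R adj X) * exp (s *\<^sub>R X)) $ 2 $ 1 \<noteq> 0"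
proof (rule ccontr)
  assume *: "\<not> ?thesis"
  have bl: "bounded_linear (\<lambda>Y :: (complex, 2) opmat. mat_of Y $ 2 $ 1)"
    by (intro bounded_linear_compose[OF bounded_linear_vec_nth] bounded_linear_mat_of)
  let ?F = "\<lambda>s. mat_of (exp (s *\<^sub>R adj X) * exp (s *\<^sub>R X)) $ 2 $ 1"
  have F0: "?F s = 0" if "s \<in> cbox 0 (1/2)" for s :: real
    using * that by (cases "s = 0") (auto simp: one_opmat.rep_eq mat_def)
  have E: "((\<lambda>h. exp (h *\<^sub>R Z)) has_vector_derivative Z) (at 0 within S)" for Z :: "(complex, 2) opmat" and S
    using exp_scaleR_has_vector_derivative_right[of Z 0 S] by simp
  have "((\<lambda>s. exp (s *\<^sub>R adj X) * exp (s *\<^sub>R X)) has_vector_derivative (adj X + X)) (at 0 within cbox 0 (1/2))"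
    by (rule has_vector_derivative_eq_rhs, (rule derivative_intros E)+) simp
  then have "(?F has_vector_derivative mat_of (adj X + X) $ 2 $ 1) (at 0 within cbox 0 (1/2))"
    by (rule bounded_linear.has_vector_derivative[OF bl])
  moreover have "(?F has_vector_derivative 0) (at 0 within cbox 0 (1/2))"
    by (rule has_vector_derivative_transform[where f = "\<lambda>_. 0"]) (auto simp: F0 simp del: cbox_interval)
  ultimately have "mat_of (adj X + X) $ 2 $ 1 = 0"
    using vector_derivative_unique_within_closed_interval[of 0 "1/2" 0 ?F] by auto
  with assms show False by simp
qed

lemma exp_inverse_scaleR:
  fixes X :: "'b::{real_normed_algebra_1,banach}"
  shows "exp (s *\<^sub>R X) * exp (- s *\<^sub>R X) = 1" "exp (- s *\<^sub>R X) * exp (s *\<^sub>R X) = 1"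
  using exp_scaleR_add[of s X "- s"] exp_scaleR_add[of "- s" X s] by simp_all

lemma exp_commute:
  fixes x y :: "'b::{real_normed_algebra_1,banach}"
  assumes "x * y = y * x"
  shows "exp x * y = y * exp x"
  unfolding exp_def bounded_linear.suminf[OF bounded_linear_mult_left summable_exp_generic]
    bounded_linear.suminf[OF bounded_linear_mult_right summable_exp_generic]
  by (simp add: power_commuting_commutes[OF assms])

text \<open>By normality \<open>X\<close> commutes with the exponential of its adjoint, so
  \<open>u\<close> may be replaced by the first axis vector e. The vectors \<open>?p\<close> and
  \<open>?q\<close> have inner product 1, so Cauchy-Schwarz gives a product of norms of at least 1.
  Equality would make e an eigenvector of
  \<open>exp (s *\<^sub>R adj X) * exp (s *\<^sub>R X)\<close>, against the nonzero off-diagonal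
  entry.\<close>

lemma norm_product_gt_one:
  fixes X :: "(complex, 2) opmat"
  assumes normal: "adj X * X = X * adj X" and r: "r > 0"
    and iso: "\<And>w. norm (mat_of X *v w) = r * norm w"
    and u: "mat_of X *v axis 1 1 = r *\<^sub>R u"
    and nz: "mat_of (adj X + X) $ 2 $ 1 \<noteq> 0"
  shows "\<exists>s>0. s < 1 \<and>
    norm (mat_of (exp (s *\<^sub>R X)) *v axis 1 1) * norm (mat_of (exp (- s *\<^sub>R adj X)) *v u) > 1"
proof -
  obtain s where s: "0 < s" "s < 1" and F: "mat_of (exp (s *\<^sub>R adj X) * exp (s *\<^sub>R X)) $ 2 $ 1 \<noteq> 0"
    using exists_entry_nonzero[OF nz] by blast
  let ?e = "axis 1 1 :: complex^2"
  let ?p = "mat_of (exp (s *\<^sub>R X)) *v ?e" and ?q = "mat_of (exp (- s *\<^sub>R adj X)) *v ?e"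
  have "exp (- s *\<^sub>R adj X) * X = X * exp (- s *\<^sub>R adj X)"
  proof -
    have "(- s *\<^sub>R adj X) * X = X * (- s *\<^sub>R adj X)" using normal by simp
    then show ?thesis by (rule exp_commute)
  qed
  then have "mat_of (exp (- s *\<^sub>R adj X)) *v (mat_of X *v ?e) = mat_of X *v ?q"
    by (metis mat_of_mult_vec)
  then have "r *\<^sub>R (mat_of (exp (- s *\<^sub>R adj X)) *v u) = mat_of X *v ?q"
    by (simp add: u linear_scale[OF matrix_vector_mul_linear])
  then have "r * norm (mat_of (exp (- s *\<^sub>R adj X)) *v u) = r * norm ?q"
    using iso[of ?q] r by (metis abs_of_pos norm_scaleR)
  then have nq: "norm (mat_of (exp (- s *\<^sub>R adj X)) *v u) = norm ?q" using r by simp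
  have adj: "adj (exp (s *\<^sub>R X)) = exp (s *\<^sub>R adj X)" by (simp add: adj_exp adj_scaleR)
  have "?p \<bullet> ?q = ?e \<bullet> (mat_of (exp (s *\<^sub>R adj X) * exp (- s *\<^sub>R adj X)) *v ?e)"
    by (simp only: inner_adj adj mat_of_mult_vec)
  also have "\<dots> = 1" by (simp add: exp_inverse_scaleR one_opmat.rep_eq power2_norm_eq_inner[symmetric] norm_axis
      flip: scaleR_minus_left del: scaleR_minus_left)
  finally have pq: "?p \<bullet> ?q = 1" .
  have "norm ?p * norm ?q \<noteq> 1"
  proof
    assume "norm ?p * norm ?q = 1"
    then have "norm ?p *\<^sub>R ?q = norm ?q *\<^sub>R ?p" using pq norm_cauchy_schwarz_eq[of ?p ?q] by simp
    then have "mat_of (exp (s *\<^sub>R adj X)) *v (norm ?p *\<^sub>R ?q) = mat_of (exp (s *\<^sub>R adj X)) *v (norm ?q *\<^sub>R ?p)"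
      by simp
    then have "norm ?p *\<^sub>R (mat_of (exp (s *\<^sub>R adj X) * exp (- s *\<^sub>R adj X)) *v ?e) =
       norm ?q *\<^sub>R (mat_of (exp (s *\<^sub>R adj X) * exp (s *\<^sub>R X)) *v ?e)"
      by (simp only: mat_of_mult_vec linear_scale[OF matrix_vector_mul_linear])
    then have "norm ?p *\<^sub>R ?e = norm ?q *\<^sub>R (mat_of (exp (s *\<^sub>R adj X) * exp (s *\<^sub>R X)) *v ?e)"
      by (simp only: exp_inverse_scaleR one_opmat.rep_eq matrix_vector_mul_lid)
    \<comment> \<open>The second coordinate is 0 on the left and, on the right, the norm of
      \<open>?q\<close> times the nonzero entry.\<close>
    then have "(norm ?p *\<^sub>R ?e) $ 2 = (norm ?q *\<^sub>R (mat_of (exp (s *\<^sub>R adj X) * exp (s *\<^sub>R X)) *v ?e)) $ 2"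
      by simp
    then have "norm ?q = 0" using F by (simp add: axis_def matrix_vector_mult_def sum_2)
    with \<open>norm ?p * norm ?q = 1\<close> show False by simp
  qed
  moreover have "norm ?p * norm ?q \<ge> 1" using norm_cauchy_schwarz[of ?p ?q] pq by simp
  ultimately show ?thesis using s nq by (intro exI[of _ s]) simp
qed

text \<open>The rank-one matrix q p*, up to scaling the norming element of the functional given by
  \<open>p\<close> and \<open>q\<close>.\<close>

lemma outer_product_matrix:
  fixes p q :: "complex^'n"
  defines "X \<equiv> (\<chi> i j. q $ i * cnj (p $ j))"
  shows "X *v p = (norm p)\<^sup>2 *\<^sub>R q" and "opnorm X \<le> norm p * norm q"
proof -
  have X: "X *v w = (\<Sum>j\<in>UNIV. cnj (p $ j) * w $ j) *s q" for w
    by (simp add: X_def vec_eq_iff matrix_vector_mult_def sum_distrib_left sum_distrib_right mult_ac)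
  have "cnj (p $ j) * p $ j = complex_of_real ((cmod (p $ j))\<^sup>2)" for j
    by (subst complex_norm_square) (rule mult.commute)
  then have "(\<Sum>j\<in>UNIV. cnj (p $ j) * p $ j) = complex_of_real ((norm p)\<^sup>2)"
    by (simp add: norm_vec_def L2_set_def sum_nonneg)
  then show "X *v p = (norm p)\<^sup>2 *\<^sub>R q"
    unfolding X by (simp add: vec_eq_iff) (simp add: scaleR_conv_of_real)
  show "opnorm X \<le> norm p * norm q"
  proof (rule opnorm_le)
    fix w
    have "cmod (\<Sum>j\<in>UNIV. cnj (p $ j) * w $ j) \<le> (\<Sum>j\<in>UNIV. \<bar>cmod (p $ j)\<bar> * \<bar>cmod (w $ j)\<bar>)"
      by (intro sum_norm_le) (simp add: norm_mult)
    also have "\<dots> \<le> norm p * norm w" unfolding norm_vec_def by (rule L2_set_mult_ineq)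
    finally have "cmod (\<Sum>j\<in>UNIV. cnj (p $ j) * w $ j) * norm q \<le> norm p * norm w * norm q"
      by (rule mult_right_mono) simp
    then show "norm (X *v w) \<le> norm p * norm q * norm w"
      unfolding X norm_vector_scalar_mult by (simp only: mult_ac)
  qed
qed

lemma needle_of_dilation:
  fixes A B :: "(complex, 2) opmat"
  assumes AB: "norm A = r" "norm B = r'" "r > 0" "r' > 0"
    and normal: "adj A * A = A * adj A"
    and iso: "\<And>w. norm (mat_of A *v w) = r * norm w"
    and u: "norm u = 1" "mat_of A *v axis 1 1 = r *\<^sub>R u" "mat_of B *v axis 1 1 = r' *\<^sub>R u"
    and nz: "mat_of (adj A + A) $ 2 $ 1 \<noteq> 0"
    and m: "0 \<le> m" "m < r + r'"
    and sum: "\<And>w. (norm (mat_of (A + B) *v w))\<^sup>2 = (r + r')\<^sup>2 * (cmod (w$1))\<^sup>2 + m\<^sup>2 * (cmod (w$2))\<^sup>2"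
  shows "needle A B"
proof -
  obtain s where s: "0 < s" "s < 1" and
    T: "norm (mat_of (exp (s *\<^sub>R A)) *v axis 1 1) * norm (mat_of (exp (- s *\<^sub>R adj A)) *v u) > 1"
    using norm_product_gt_one[OF normal AB(3) iso u(2) nz] by blast
  define p q where "p = mat_of (exp (s *\<^sub>R A)) *v axis 1 1" and "q = mat_of (exp (- s *\<^sub>R adj A)) *v u"
  have pq: "norm p > 0" "norm q > 0" "norm p * norm q > 1" using T by (auto simp: p_def q_def)
  \<comment> \<open>Scaled so that the needle costs no more than the piece of \<open>A\<close> it
    replaces, while its transported effect at the corner is as large as possible.\<close>
  define X where "X = (r / (norm p * norm q)) *\<^sub>R Op (\<chi> i j. q $ i * cnj (p $ j))"
  have "norm X = r / (norm p * norm q) * opnorm (\<chi> i j. q $ i * cnj (p $ j))"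
    using AB(3) unfolding X_def norm_scaleR norm_opmat.rep_eq[of "Op _"] by (simp add: Op_inverse)
  also have "\<dots> \<le> r / (norm p * norm q) * (norm p * norm q)"
    using AB(3) by (intro mult_left_mono outer_product_matrix) auto
  also have "\<dots> = r" using pq by simp
  finally have X: "norm X \<le> r" .
  have Xp: "mat_of X *v p = (r * norm p / norm q) *\<^sub>R q"
  proof -
    have "mat_of X *v p = (r / (norm p * norm q)) *\<^sub>R ((\<chi> i j. q $ i * cnj (p $ j)) *v p)"
      by (simp add: X_def scaleR_opmat.rep_eq Op_inverse vec_eq_iff matrix_vector_mult_def scaleR_sum_right)
    also have "\<dots> = (r * norm p / norm q) *\<^sub>R q"
      unfolding outer_product_matrix using pq by (simp add: power2_eq_square)
    finally show ?thesis .
  qed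
  define D where "D = A - exp (- s *\<^sub>R A) * X * exp (s *\<^sub>R A)"
  have "mat_of D *v axis 1 1 = r *\<^sub>R u - mat_of (exp (- s *\<^sub>R A)) *v (mat_of X *v p)"
    by (simp add: D_def minus_opmat.rep_eq matrix_vector_mult_diff_rdistrib u mat_of_mult_vec p_def)
  then have "u \<bullet> (mat_of D *v axis 1 1) =
      r - (r * norm p / norm q) * (u \<bullet> (mat_of (exp (- s *\<^sub>R A)) *v q))"
    by (simp add: Xp inner_diff_right linear_scale[OF matrix_vector_mul_linear] u(1) power2_norm_eq_inner[symmetric])
  \<comment> \<open>Moving the exponential to the other side of the inner product turns
    \<open>u\<close> into \<open>q\<close>.\<close>
  also have "u \<bullet> (mat_of (exp (- s *\<^sub>R A)) *v q) = q \<bullet> q"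
  proof -
    have "adj (exp (- s *\<^sub>R A)) = exp (- s *\<^sub>R adj A)" by (simp only: adj_exp adj_scaleR)
    then show ?thesis by (metis inner_adj inner_commute q_def)
  qed
  also have "r - (r * norm p / norm q) * (q \<bullet> q) = r * (1 - norm p * norm q)"
    using pq by (simp add: power2_norm_eq_inner[symmetric] power2_eq_square algebra_simps)
  also have "\<dots> < 0" using pq AB(3) by (simp add: mult_pos_neg)
  finally have D: "u \<bullet> (mat_of D *v axis 1 1) < 0" .
  have u': "mat_of (A + B) *v axis 1 1 = (r + r') *\<^sub>R u"
    by (simp add: plus_opmat.rep_eq matrix_vector_mult_add_rdistrib u scaleR_add_left)
  obtain \<epsilon> where \<epsilon>: "\<epsilon> > 0" "opnorm (mat_of (A + B) + \<epsilon> *\<^sub>R mat_of D) < r + r'"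
    using opnorm_perturb_less[OF _ m u(1) u' sum D] AB by auto
  then have "norm ((A + B) + \<epsilon> *\<^sub>R D) < r + r'"
    by (simp add: norm_opmat.rep_eq plus_opmat.rep_eq scaleR_opmat.rep_eq)
  moreover have "norm ((1 / \<epsilon>) *\<^sub>R (A + B) + D) = norm ((A + B) + \<epsilon> *\<^sub>R D) / \<epsilon>"
  proof -
    have "(1 / \<epsilon>) *\<^sub>R (A + B) + D = (1 / \<epsilon>) *\<^sub>R ((A + B) + \<epsilon> *\<^sub>R D)"
      using \<epsilon>(1) by (simp add: scaleR_add_right)
    then show ?thesis using \<epsilon>(1) by simp
  qed
  \<comment> \<open>Dividing by \<epsilon> puts the perturbation in the form required by
    \<open>needle\<close>, with N = 1/\<epsilon>.\<close>
  ultimately have "norm ((1 / \<epsilon>) *\<^sub>R (A + B) + D) < 1 / \<epsilon> * (r + r')"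
    using \<epsilon>(1) by (simp add: divide_strict_right_mono)
  then have "norm X + norm ((1 / \<epsilon>) *\<^sub>R (A + B) + A - exp (- s *\<^sub>R A) * X * exp (s *\<^sub>R A))
      < norm A + 1 / \<epsilon> * (norm A + norm B)"
    using X by (simp add: D_def AB add_diff_eq)
  then show ?thesis unfolding needle_def using s \<epsilon>(1) by (intro exI[of _ s] exI[of _ "1/\<epsilon>"] exI[of _ X]) simp
qed

section \<open>The explicit skew forms\<close>

lemma cmod_rotation:
  "(cmod (x * complex_of_real (cos t) - y * complex_of_real (sin t)))\<^sup>2 +
   (cmod (x * complex_of_real (sin t) + y * complex_of_real (cos t)))\<^sup>2 = (cmod x)\<^sup>2 + (cmod y)\<^sup>2"
proof -
  have "(a * cos t - b * sin t)\<^sup>2 + (a * sin t + b * cos t)\<^sup>2 = a\<^sup>2 + b\<^sup>2" for a b :: real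
  proof -
    have "(a * cos t - b * sin t)\<^sup>2 + (a * sin t + b * cos t)\<^sup>2 = (a\<^sup>2 + b\<^sup>2) * ((sin t)\<^sup>2 + (cos t)\<^sup>2)"
      by algebra
    then show ?thesis by simp
  qed
  from this[of "Re x" "Re y"] this[of "Im x" "Im y"] show ?thesis
    by (simp add: cmod_power2)
qed

text \<open>Forms with common t and \<eta> are the same rotation times diagonal matrices, so their
  sum has the moduli of the summed diagonal entries as singular values.\<close>

lemma norm_skew_form_sum:
  "(norm ((skew_form t \<eta> \<theta> r + skew_form t \<eta> \<phi> r') *v w))\<^sup>2 =
    (r + r')\<^sup>2 * (cmod (w$1))\<^sup>2 + (cmod (r * cis \<theta> + r' * cis \<phi>))\<^sup>2 * (cmod (w$2))\<^sup>2"
proof -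
  define x y where "x = (r + r') * cis \<eta> * w$1" and "y = (r * cis \<theta> + r' * cis \<phi>) * w$2"
  have 1: "((skew_form t \<eta> \<theta> r + skew_form t \<eta> \<phi> r') *v w) $ 1 = x * cos t - y * sin t"
    by (simp add: skew_form_def matrix_vector_mult_def sum_2 x_def y_def algebra_simps)
  have 2: "((skew_form t \<eta> \<theta> r + skew_form t \<eta> \<phi> r') *v w) $ 2 = x * sin t + y * cos t"
    by (simp add: skew_form_def matrix_vector_mult_def sum_2 x_def y_def algebra_simps)
  have "cmod x = \<bar>r + r'\<bar> * cmod (w$1)"
    unfolding x_def norm_mult by (simp flip: of_real_add)
  then show ?thesis
    unfolding norm_vec2 1 2 cmod_rotation by (simp add: y_def norm_mult power_mult_distrib)
qed

lemma norm_skew_form: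
  assumes "r > 0"
  shows "norm (skew_form t \<eta> \<theta> r *v w) = r * norm w" and "opnorm (skew_form t \<eta> \<theta> r) = r"
proof -
  \<comment> \<open>A single form is treated as a sum whose second summand has radius 0.\<close>
  have z: "skew_form t \<eta> \<theta> 0 = 0" by (simp add: skew_form_def vec_eq_iff)
  show *: "norm (skew_form t \<eta> \<theta> r *v w) = r * norm w" for w
  proof (rule power2_eq_imp_eq)
    show "(norm (skew_form t \<eta> \<theta> r *v w))\<^sup>2 = (r * norm w)\<^sup>2"
      using norm_skew_form_sum[of t \<eta> \<theta> r \<theta> 0 w] z
      by (simp add: norm_mult power_mult_distrib norm_vec2[of w] distrib_left)
  qed (use assms in auto)
  show "opnorm (skew_form t \<eta> \<theta> r) = r"
  proof (rule antisym)
    show "opnorm (skew_form t \<eta> \<theta> r) \<le> r" by (rule opnorm_le) (simp add: *)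
    show "r \<le> opnorm (skew_form t \<eta> \<theta> r)"
      using norm_matrix_vector_mult_le_opnorm[of "skew_form t \<eta> \<theta> r" "axis 1 1"]
      by (simp add: * norm_axis)
  qed
qed

lemma cadj_skew_form:
  "cadj (skew_form t \<eta> \<theta> r) ** skew_form t \<eta> \<theta> r = skew_form t \<eta> \<theta> r ** cadj (skew_form t \<eta> \<theta> r)"
  by (simp add: vec_eq_iff forall_2 matrix_matrix_mult_def sum_2 cadj_nth skew_form_def cis_cnj cis_mult)

text \<open>The entry of A* + A is r sin t (cis \<eta> - cis (-\<theta>)), nonzero by the
  assumptions on t and \<eta>. Distinct directions \<theta> and \<phi> make the triangle inequality
  strict, which separates the second singular value of the sum from r + r'. Angles enter only
  through \<open>cis\<close>, so that they may be shifted by pi out of the standard range.\<close>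

lemma needle_skew_form:
  assumes r: "r > 0" "r' > 0" and t: "sin t \<noteq> 0" and \<phi>: "cis \<phi> \<noteq> cis \<theta>" and \<eta>: "cis \<eta> \<noteq> cis (- \<theta>)"
  shows "needle (Op (skew_form t \<eta> \<theta> r)) (Op (skew_form t \<eta> \<phi> r'))"
proof (rule needle_of_dilation[where r = r and r' = r' and m = "cmod (r * cis \<theta> + r' * cis \<phi>)"
      and u = "\<chi> i. cis \<eta> * (if i = 1 then cos t else sin t)"])
  let ?P = "skew_form t \<eta> \<theta> r"
  show "norm (Op ?P) = r" "norm (Op (skew_form t \<eta> \<phi> r')) = r'"
    using r by (simp_all add: norm_opmat.rep_eq Op_inverse norm_skew_form)
  show "adj (Op ?P) * Op ?P = Op ?P * adj (Op ?P)"
    by (simp add: mat_of_inject[symmetric] times_opmat.rep_eq adj.rep_eq Op_inverse cadj_skew_form)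
  show "norm (mat_of (Op ?P) *v w) = r * norm w" for w
    using r by (simp add: Op_inverse norm_skew_form)
  have "(norm (\<chi> i. cis \<eta> * complex_of_real (if i = 1 then cos t else sin t) :: complex^2))\<^sup>2 = 1"
    by (simp add: norm_vec2 norm_mult)
  then show "norm (\<chi> i. cis \<eta> * complex_of_real (if i = 1 then cos t else sin t) :: complex^2) = 1"
    by (metis norm_ge_zero one_power2 power2_eq_imp_eq zero_le_one)
  have "mat_of (Op (skew_form t \<eta> x y)) *v axis 1 1 =
      y *\<^sub>R (\<chi> i. cis \<eta> * complex_of_real (if i = 1 then cos t else sin t))" for x y
    by (simp add: Op_inverse vec_eq_iff forall_2 matrix_vector_mult_def sum_2 axis_def skew_form_def
        scaleR_conv_of_real[where 'a=complex])
  then show "mat_of (Op ?P) *v axis 1 1 =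
      r *\<^sub>R (\<chi> i. cis \<eta> * complex_of_real (if i = 1 then cos t else sin t))"
    and "mat_of (Op (skew_form t \<eta> \<phi> r')) *v axis 1 1 =
      r' *\<^sub>R (\<chi> i. cis \<eta> * complex_of_real (if i = 1 then cos t else sin t))" by blast+
  have "mat_of (adj (Op ?P) + Op ?P) $ 2 $ 1 = r * sin t * (cis \<eta> - cis (- \<theta>))"
    by (simp add: plus_opmat.rep_eq adj.rep_eq Op_inverse cadj_nth skew_form_def cis_cnj algebra_simps)
  then show "mat_of (adj (Op ?P) + Op ?P) $ 2 $ 1 \<noteq> 0" using r t \<eta> by simp
  show "(norm (mat_of (Op ?P + Op (skew_form t \<eta> \<phi> r')) *v w))\<^sup>2 =
      (r + r')\<^sup>2 * (cmod (w$1))\<^sup>2 + (cmod (r * cis \<theta> + r' * cis \<phi>))\<^sup>2 * (cmod (w$2))\<^sup>2" for w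
    by (simp add: plus_opmat.rep_eq Op_inverse norm_skew_form_sum)
  have "cmod (r * cis \<theta> + r' * cis \<phi>) \<noteq> cmod (r * cis \<theta>) + cmod (r' * cis \<phi>)"
    unfolding norm_triangle_eq using r \<phi> by (simp add: norm_mult scaleR_conv_of_real)
  then show "cmod (r * cis \<theta> + r' * cis \<phi>) < r + r'"
    using r norm_triangle_ineq[of "r * cis \<theta>" "r' * cis \<phi>"] by (simp add: norm_mult)
qed (use r in auto)

lemma cis_add_pi: "cis (x + pi) = - cis x"
  by (simp add: cis_mult[symmetric])

lemma uminus_skew_form: "- skew_form t \<eta> \<theta> r = skew_form t (\<eta> + pi) (\<theta> + pi) r"
  by (simp add: skew_form_def vec_eq_iff forall_2 cis_add_pi)

lemma cis_eq_imp_eq: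
  assumes "cis x = cis y" "x \<in> {0..<2*pi}" "y \<in> {0..<2*pi}"
  shows "x = y"
proof -
  obtain n :: int where n: "x = y + 2 * pi * n"
    using sin_cos_eq_iff[of x y] assms(1) by (auto simp: cis.ctr complex_eq_iff)
  have "\<bar>x - y\<bar> < 2 * pi" using assms(2,3) by auto
  then have "2 * pi * \<bar>real_of_int n\<bar> < 2 * pi * 1" by (simp add: n abs_mult)
  then have "n = 0" by (simp only: mult_less_cancel_left_pos[OF pi_gt_zero] mult.assoc) simp
  then show ?thesis using n by simp
qed

lemma skew_aligned_imp_needle:
  assumes "skew_aligned A B"
  shows "needle (Op A) (Op B) \<or> needle (- Op B) (- Op A)"
proof -
  from assms obtain U r r' t \<eta> \<theta> \<phi> where U: "unitary U" and r: "r > 0" "r' > 0" and t: "0 < t" "t < pi"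
    and ang: "\<theta> \<in> {0..<2*pi}" "\<phi> \<in> {0..<2*pi}" "\<phi> \<noteq> \<theta>"
    and AB: "U ** A ** cadj U = skew_form t \<eta> \<theta> r" "U ** B ** cadj U = skew_form t \<eta> \<phi> r'"
    unfolding skew_aligned_def by blast
  have cis: "cis \<phi> \<noteq> cis \<theta>" using cis_eq_imp_eq ang by blast
  have st: "sin t \<noteq> 0" using sin_gt_zero[OF t] by simp
  have isom: "norm (Op V) \<le> 1" if "cadj V ** V = mat 1" for V :: "complex^2^2"
  proof -
    have "opnorm V \<le> 1"
    proof (rule opnorm_le)
      fix w :: "complex^2"
      have "(V *v w) \<bullet> (V *v w) = w \<bullet> w"
        using inner_adj[of "Op V" w "V *v w"] that by (simp add: Op_inverse adj.rep_eq matrix_vector_mul_assoc)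
      then show "norm (V *v w) \<le> 1 * norm w" by (simp add: norm_eq_sqrt_inner)
    qed
    then show ?thesis by (simp add: norm_opmat.rep_eq Op_inverse)
  qed
  have cc: "cadj (cadj U) = U" by (simp add: vec_eq_iff cadj_nth)
  have u: "Op U * Op (cadj U) = 1" "Op (cadj U) * Op U = 1" "norm (Op U) \<le> 1" "norm (Op (cadj U)) \<le> 1"
    using U isom[of U] isom[of "cadj U"] cc
    by (auto simp: unitary_def mat_of_inject[symmetric] times_opmat.rep_eq one_opmat.rep_eq Op_inverse)
  have conj: "Op U * Op A * Op (cadj U) = Op (skew_form t \<eta> \<theta> r)"
    "Op U * Op B * Op (cadj U) = Op (skew_form t \<eta> \<phi> r')"
    using AB by (simp_all add: mat_of_inject[symmetric] times_opmat.rep_eq Op_inverse)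
  show ?thesis
  \<comment> \<open>The variation along \<open>A\<close> fails only if cis \<eta> = cis (-\<theta>).
    Then cis \<eta> differs from cis (-\<phi>), and the variation is made in the inverse path, along
    the negative of \<open>B\<close>.\<close>
  proof (cases "cis \<eta> = cis (- \<theta>)")
    case False
    then have "needle (Op (skew_form t \<eta> \<theta> r)) (Op (skew_form t \<eta> \<phi> r'))"
      using needle_skew_form[OF r st cis] by blast
    then show ?thesis using needle_conj[OF u] conj by metis
  next
    case True
    have "cis \<eta> \<noteq> cis (- \<phi>)" using cis True by (metis cis_cnj complex_cnj_cnj)
    then have "cis (\<eta> + pi) \<noteq> cis (- (\<phi> + pi))"
      by (metis cis_add_pi cis_cnj complex_cnj_minus neg_equal_iff_equal)
    then have "needle (Op (skew_form t (\<eta> + pi) (\<phi> + pi) r')) (Op (skew_form t (\<eta> + pi) (\<theta> + pi) r))"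
      using cis by (intro needle_skew_form r st) (auto simp: cis_add_pi)
    moreover have "Op U * (- Op A) * Op (cadj U) = Op (skew_form t (\<eta> + pi) (\<theta> + pi) r)"
      "Op U * (- Op B) * Op (cadj U) = Op (skew_form t (\<eta> + pi) (\<phi> + pi) r')"
      by (simp_all add: conj uminus_skew_form[symmetric] mat_of_inject[symmetric] uminus_opmat.rep_eq Op_inverse)
    ultimately show ?thesis using needle_conj[OF u, of "- Op B" "- Op A"] by metis
  qed
qed

theorem theorem5p4:
  shows "(\<forall>A B :: real^2^2. rnormal A \<and> rnormal B \<and> skew_aligned (cplx A) (cplx B) \<longrightarrow>
            magnus (mexp A ** mexp B) < opnorm A + opnorm B) \<and>
         (\<forall>A B :: complex^2^2. cnormal A \<and> cnormal B \<and> skew_aligned A B \<longrightarrow>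
            magnus (mexp A ** mexp B) < opnorm A + opnorm B)"
proof (intro conjI allI impI; elim conjE)
  fix A B :: "real^2^2"
  assume "skew_aligned (cplx A) (cplx B)"
  moreover have "Op (cplx C) = op_of_real (Op C)" "- Op (cplx C) = op_of_real (- Op C)" for C :: "real^2^2"
    by (simp_all add: mat_of_inject[symmetric] op_of_real.rep_eq uminus_opmat.rep_eq Op_inverse cplx_def vec_eq_iff)
  ultimately have "needle (Op A) (Op B) \<or> needle (- Op B) (- Op A)"
    using skew_aligned_imp_needle[of "cplx A" "cplx B"] needle_op_of_real by metis
  then show "magnus (mexp A ** mexp B) < opnorm A + opnorm B"
    using needle_imp_shortcut shortcut_inverse shortcut_imp_magnus_less by blast
next
  fix A B :: "complex^2^2"
  assume "skew_aligned A B"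
  then show "magnus (mexp A ** mexp B) < opnorm A + opnorm B"
    using skew_aligned_imp_needle needle_imp_shortcut shortcut_inverse shortcut_imp_magnus_less by blast
qed

end
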